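(* Let $S : \mathbb{R}^n \rightrightarrows \mathbb{R}^n$ be a set-valued mapping that is outer semicontinuous (at every point), locally bounded, and has convex domain $\operatorname{dom} S$. Suppose there exist nonempty subsets $A$ and $B$ of $\operatorname{gph} S$ which are disjoint from each other's closure, that is, $A \cap \overline{B} = \overline{A} \cap B = \varnothing$, and a point $x_0 \in \operatorname{dom} S$, such that $\operatorname{gph} S = A \cup B$ and $\{(x_0,v) \mid v \in S(x_0)\} \subseteq A$. Then $S$ is not inner semicontinuous (i.e. there is a point at which $S$ fails to be inner semicontinuous). Moreover, there exists a point where $S$ is multivalued.
   Context: A set-valued mapping $S:\mathbb{R}^n\rightrightarrows\mathbb{R}^m$ assigns to each $x\in\mathbb{R}^n$ a (possibly empty) subset $S(x)\subseteq\mathbb{R}^m$. Its graph is $\operatorname{gph} S=\{(x,u)\mid u\in S(x)\}$ and its domain is $\operatorname{dom} S=\{x\mid S(x)\neq\varnothing\}$. $S$ is multivalued at $x$ if $S(x)$ contains more than one element. Closures $\overline{A},\overline{B}$ are taken in $\mathbb{R}^n\times\mathbb{R}^n$. $S$ is locally bounded if whenever $u^\nu\in S(x^\nu)$ and the sequence $\{x^\nu\}_{\nu\in\mathbb{N}}$ is bounded, the sequence $\{u^\nu\}_{\nu\in\mathbb{N}}$ is bounded. Outer and inner limits: $\limsup_{x\to\bar x}S(x)=\{u\mid \exists x^\nu\to\bar x,\ \exists u^\nu\to u \text{ with } u^\nu\in S(x^\nu)\}$; $\liminf_{x\to\bar x}S(x)$ is the set of $u$ such that for every sequence $x^\nu\to\bar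 x$ there exist a set $N\subseteq\mathbb{N}$ containing all sufficiently large $\nu$ and points $u^\nu\in S(x^\nu)$ for $\nu\in N$ with $u^\nu\to u$. $S$ is outer semicontinuous at $\bar x$ if $\limsup_{x\to\bar x}S(x)\subseteq S(\bar x)$, and inner semicontinuous at $\bar x$ if $\liminf_{x\to\bar x}S(x)\supseteq S(\bar x)$. *)

theory Defs
  imports "HOL-Analysis.Analysis"
begin

text \<open>A set-valued mapping is a total function into sets; the empty value is allowed.\<close>

definition gph :: "('a \<Rightarrow> 'b set) \<Rightarrow> ('a \<times> 'b) set" where
  "gph S = {(x, u). u \<in> S x}"

definition sv_dom :: "('a \<Rightarrow> 'b set) \<Rightarrow> 'a set" where
  "sv_dom S = {x. S x \<noteq> {}}"

definition multivalued_at :: "('a \<Rightarrow> 'b set) \<Rightarrow> 'a \<Rightarrow> bool" where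
  "multivalued_at S x \<longleftrightarrow> (\<exists>u v. u \<in> S x \<and> v \<in> S x \<and> u \<noteq> v)"

definition locally_bounded ::
    "('a::metric_space \<Rightarrow> 'b::metric_space set) \<Rightarrow> bool" where
  "locally_bounded S \<longleftrightarrow>
     (\<forall>x u :: nat \<Rightarrow> _. (\<forall>\<nu>. u \<nu> \<in> S (x \<nu>)) \<longrightarrow> bounded (range x) \<longrightarrow> bounded (range u))"

definition outer_limit ::
    "('a::topological_space \<Rightarrow> 'b::topological_space set) \<Rightarrow> 'a \<Rightarrow> 'b set" where
  "outer_limit S xbar =
     {u. \<exists>x w. x \<longlonglongrightarrow> xbar \<and> w \<longlonglongrightarrow> u \<and> (\<forall>\<nu>. w \<nu> \<in> S (x \<nu>))}"

text \<open>The points \<open>w \<nu>\<close> are only constrained for \<open>\<nu> \<in> N\<close>.  As \<open>N\<close> contains all large \<open>\<nu>\<close>,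
  the arbitrary values of \<open>w\<close> outside \<open>N\<close> do not affect convergence.  The sequences \<open>x\<close> range over
  the whole space, not only over the domain of \<open>S\<close>.\<close>

definition inner_limit ::
    "('a::topological_space \<Rightarrow> 'b::topological_space set) \<Rightarrow> 'a \<Rightarrow> 'b set" where
  "inner_limit S xbar =
     {u. \<forall>x. x \<longlonglongrightarrow> xbar \<longrightarrow>
       (\<exists>N w. (\<forall>\<^sub>F \<nu> in sequentially. \<nu> \<in> N) \<and> (\<forall>\<nu>\<in>N. w \<nu> \<in> S (x \<nu>)) \<and> w \<longlonglongrightarrow> u)}"

definition outer_semicontinuous_at ::
    "('a::topological_space \<Rightarrow> 'b::topological_space set) \<Rightarrow> 'a \<Rightarrow> bool" where
  "outer_semicontinuous_at S xbar \<longleftrightarrow> outer_limit S xbar \<subseteq> S xbar"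

definition inner_semicontinuous_at ::
    "('a::topological_space \<Rightarrow> 'b::topological_space set) \<Rightarrow> 'a \<Rightarrow> bool" where
  "inner_semicontinuous_at S xbar \<longleftrightarrow> S xbar \<subseteq> inner_limit S xbar"

end

theory Submission
  imports Defs
begin

text \<open>Both pieces \<open>A\<close> and \<open>B\<close> are closed, and local boundedness makes their projections to the
  domain closed as well. These projections cover the connected domain, so they meet, and over a
  common point \<open>S\<close> has two values. If \<open>S\<close> were inner semicontinuous, the projection of \<open>B\<close> would
  also be open: near a point \<open>x\<close> of it, graph points approximating a point of \<open>B\<close> over \<open>x\<close> cannot
  all lie in \<open>A\<close>. It would then be the whole space, yet it misses \<open>x\<^sub>0\<close>.\<close>

lemma closed_gph:
  fixes S :: "'a::metric_space \<Rightarrow> 'b::metric_space set"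
  assumes "\<And>x. outer_semicontinuous_at S x"
  shows "closed (gph S)"
  unfolding closed_sequential_limits
proof (intro allI impI, elim conjE)
  fix z l assume z: "\<forall>n. z n \<in> gph S" and lim: "z \<longlonglongrightarrow> l"
  have "(\<lambda>n. fst (z n)) \<longlonglongrightarrow> fst l" "(\<lambda>n. snd (z n)) \<longlonglongrightarrow> snd l"
    using lim by (auto intro: tendsto_intros)
  moreover have "\<forall>n. snd (z n) \<in> S (fst (z n))"
    using z by (auto simp: gph_def case_prod_beta)
  ultimately have "snd l \<in> outer_limit S (fst l)"
    unfolding outer_limit_def mem_Collect_eq by blast
  then show "l \<in> gph S"
    using assms[of "fst l"] by (auto simp: outer_semicontinuous_at_def gph_def case_prod_beta)
qed

text \<open>A limit point of \<open>A\<close> stays in the closed union and cannot lie in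
  \<open>B\<close>. By symmetry this serves for both pieces of the graph.\<close>

lemma closed_left_part:
  assumes "closed (A \<union> B)" and "closure A \<inter> B = {}"
  shows "closed A"
proof -
  have "closure A \<subseteq> A \<union> B"
    using assms(1) by (intro closure_minimal) auto
  with assms(2) have "closure A \<subseteq> A" by blast
  then show ?thesis
    by (simp add: closure_subset_eq)
qed

text \<open>Local boundedness supplies the compactness that projecting a closed set requires: values
  over a convergent sequence are bounded, so a subsequence of them converges and \<open>C\<close>
  contains the limit pair.\<close>

lemma closed_fst_image:
  fixes S :: "'a::metric_space \<Rightarrow> 'b::heine_borel set"
  assumes bdd: "locally_bounded S" and "closed C" and sub: "C \<subseteq> gph S"
  shows "closed (fst ` C)"
  unfolding closed_sequential_limits
proof (intro allI impI, elim conjE)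
  fix x l assume "\<forall>n. x n \<in> fst ` C" and lim: "x \<longlonglongrightarrow> l"
  then have "\<forall>n. \<exists>u. (x n, u) \<in> C" by force
  then obtain u where u: "\<And>n. (x n, u n) \<in> C" by metis
  with sub have "\<forall>n. u n \<in> S (x n)" by (auto simp: gph_def)
  moreover have "bounded (range x)"
    using lim by (rule convergent_imp_bounded)
  ultimately have "bounded (range u)"
    using bdd unfolding locally_bounded_def by blast
  then obtain m r where r: "strict_mono (r :: nat \<Rightarrow> nat)" and m: "(u \<circ> r) \<longlonglongrightarrow> m"
    using bounded_imp_convergent_subsequence by blast
  have "(\<lambda>n. (x (r n), u (r n))) \<longlonglongrightarrow> (l, m)"
    using LIMSEQ_subseq_LIMSEQ[OF lim r] m by (intro tendsto_Pair) (auto simp: o_def)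
  then have "(l, m) \<in> C"
    by (rule closed_sequentially[OF \<open>closed C\<close> u])
  then show "l \<in> fst ` C" by force
qed

lemma open_fst_image:
  fixes S :: "'a::metric_space \<Rightarrow> 'b::metric_space set"
  assumes isc: "\<And>x. inner_semicontinuous_at S x"
    and gph: "gph S = A \<union> B" and disj: "closure A \<inter> B = {}"
  shows "open (fst ` B)"
proof -
  have "closed (- fst ` B)"
    unfolding closed_sequential_limits
  proof (intro allI impI, elim conjE)
    fix x l assume x: "\<forall>n. x n \<in> - fst ` B" and lim: "x \<longlonglongrightarrow> l"
    show "l \<in> - fst ` B"
    proof
      assume "l \<in> fst ` B"
      then obtain u where u: "(l, u) \<in> B" by force
      then have "u \<in> S l" using gph by (auto simp: gph_def)
      then have "u \<in> inner_limit S l"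
        using isc[of l] by (auto simp: inner_semicontinuous_at_def)
      \<comment> \<open>The points \<open>x n\<close> may lie outside the domain of
        \<open>S\<close>; the inner limit still yields values for all large \<open>n\<close>. Hence
        openness holds in the whole space, not only relative to the domain.\<close>
      then obtain N w where N: "\<forall>\<^sub>F n in sequentially. n \<in> N"
        and w: "\<forall>n\<in>N. w n \<in> S (x n)" and wu: "w \<longlonglongrightarrow> u"
        using lim unfolding inner_limit_def mem_Collect_eq by blast
      \<comment> \<open>No point of \<open>B\<close> lies over \<open>x n\<close>, so the piece
        containing this pair must be \<open>A\<close>.\<close>
      have "(x n, w n) \<in> A" if "n \<in> N" for n
      proof -
        have "(x n, w n) \<in> A \<union> B"
          using w that unfolding gph[symmetric] by (auto simp: gph_def)
        with x show ?thesis by force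
      qed
      with N have "\<forall>\<^sub>F n in sequentially. (x n, w n) \<in> closure A"
        by (auto elim!: eventually_mono intro: closure_subset[THEN subsetD])
      then have "(l, u) \<in> closure A"
        using Lim_in_closed_set[OF closed_closure _ sequentially_bot tendsto_Pair[OF lim wu]]
        by blast
      with u disj show False by blast
    qed
  qed
  then show ?thesis by (simp add: closed_def)
qed

theorem theorem3p1:
  fixes S :: "real ^ 'n \<Rightarrow> (real ^ 'n) set"
    and A B :: "((real ^ 'n) \<times> (real ^ 'n)) set"
    and x\<^sub>0 :: "real ^ 'n"
  assumes "\<And>x. outer_semicontinuous_at S x"
    and "locally_bounded S"
    and "convex (sv_dom S)"
    and "A \<noteq> {}" and "B \<noteq> {}"
    and "A \<subseteq> gph S" and "B \<subseteq> gph S"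
    and "A \<inter> closure B = {}" and "closure A \<inter> B = {}"
    and "x\<^sub>0 \<in> sv_dom S"
    and "gph S = A \<union> B"
    and "{(x\<^sub>0, v) | v. v \<in> S x\<^sub>0} \<subseteq> A"
  shows "(\<exists>x. \<not> inner_semicontinuous_at S x) \<and> (\<exists>x. multivalued_at S x)"
proof
  have "closed (gph S)"
    using assms(1) by (rule closed_gph)
  then have "closed A" "closed B"
    using closed_left_part[of A B] closed_left_part[of B A] assms(8,9,11)
    by (auto simp: Un_commute Int_commute)
  then have closed_proj: "closed (fst ` A)" "closed (fst ` B)"
    using closed_fst_image[OF assms(2)] assms(6,7) by blast+
  have disj: "A \<inter> B = {}"
    using assms(9) closure_subset by blast
  show "\<exists>x. \<not> inner_semicontinuous_at S x"
  proof (rule ccontr)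
    assume "\<not> ?thesis"
    then have "open (fst ` B)"
      using open_fst_image assms(9,11) by blast
    \<comment> \<open>The whole space is connected, so a nonempty clopen subset is
      everything.\<close>
    with closed_proj(2) have "fst ` B = UNIV"
      using clopen[of "fst ` B"] assms(5) by simp
    then have "x\<^sub>0 \<in> fst ` B" by simp
    then obtain v where "(x\<^sub>0, v) \<in> B" by force
    then show False
      using assms(7,12) disj by (auto simp: gph_def)
  qed
  have dom: "sv_dom S = fst ` A \<union> fst ` B"
    unfolding image_Un[symmetric] assms(11)[symmetric] by (force simp: sv_dom_def gph_def)
  \<comment> \<open>Otherwise two disjoint nonempty closed sets would separate the convex
    domain.\<close>
  have "fst ` A \<inter> fst ` B \<noteq> {}"
    using convex_connected[OF assms(3)] closed_proj assms(4,5)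
    unfolding connected_closed dom by blast
  then obtain x u v where "(x, u) \<in> A" "(x, v) \<in> B" by force
  \<comment> \<open>Disjointness of \<open>A\<close> and \<open>B\<close> forces \<open>u\<close>
    and \<open>v\<close> to differ.\<close>
  then show "\<exists>x. multivalued_at S x"
    using assms(6,7) disj unfolding multivalued_at_def gph_def by blast
qed

end
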